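(* Let $\Gamma=(N,A,\mathcal F,\Delta,u)$ be a strategic form game with countably additive strategies, and let $\sigma$ be a perfect equilibrium of $\Gamma$. Then $\sigma$ is a weak perfect equilibrium of $\Gamma$.
   Context: A directed set $(I,\le)$ is a non-empty set with a reflexive, transitive relation such that every pair has an upper bound and there is no maximal element (for every $\alpha$ there is $\beta\ge\alpha$ with $\beta\neq\alpha$). Nets are indexed by directed sets; convergence is as usual. A strategic form game with countably additive strategies $\Gamma=(N,A,\mathcal F,\Delta,u)$ consists of: $N=\{1,\dots,n\}$; $A=\prod_{i\in N}A_i$ with each $A_i$ a non-empty compact metric space with metric $d_i$; $\mathcal F_i$ the Borel sigma-field of $A_i$; $\Delta=\prod_i\Delta_i$, where $\Delta_i$ is the set of countably additive probability measures on $\mathcal F_i$; continuous functions $u_i\colon A\to\mathbb R$; payoff functions $U_i(\sigma)=\int_Au_i\,d(\sigma_1\otimes\cdots\otimes\sigma_n)$. $\Delta$ has the topology of weak convergence, metrized by the Prohorov metric: with $d(a,b)=\max_id_i(a_i,b_i)$ on $A$, and identifying a profile $\sigma$ with its product measure on the Borel sets of $A$, $d_P(\sigma,\tau)=\inf\{\varepsilon>0\mid\sigma(B)\le\tau(B_\varepsilon)+\varepsilon\text{ and }\tau(B)\le\sigma(B_\varepsilon)+\varepsilon\text{ for all Borel }B\subseteq A\}$, where $B_\varepsilon=\{a\in A\mid d(a,B)<\varepsilon\}$. $(\tau_i\mid\sigma)$ is the profile $\sigma$ with $\sigma_i$ replaced by $\tau_i$. $\tau_i\in\Delta_i$ is a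 best response to $\sigma\in\Delta$ if $U_i(\tau_i\mid\sigma)\ge U_i(\tau_i'\mid\sigma)$ for all $\tau_i'\in\Delta_i$; a profile $\tau$ is a best response to $\sigma$ if each $\tau_i$ is. $\sigma$ is a Nash equilibrium if it is a best response to itself. The carrier of $\sigma_i\in\Delta_i$ is $\mathcal C_i(\sigma_i)=\{E\in\mathcal F_i\mid\sigma_i(E)>0\}$, and $\mathcal C(\sigma)=\prod_i\mathcal C_i(\sigma_i)$. A carrier is a set of the form $\mathcal C(\sigma)$ with $\sigma\in\Delta$. A net $(\sigma_\alpha)_{\alpha\in I}$ in $\Delta$ is completely mixed if for every carrier $\mathcal C$ there is $\alpha\in I$ with $\mathcal C\subseteq\mathcal C(\sigma_\beta)$ for all $\beta\ge\alpha$. $\sigma$ is perfect if there are a completely mixed net $(\sigma_\alpha)_{\alpha\in I}$ and a net $(\kappa_\alpha)_{\alpha\in I}$ in $\Delta$, both converging to $\sigma$, such that $\kappa_\alpha$ is a best response to $\sigma_\alpha$ for each $\alpha\in I$. A perfect equilibrium is a Nash equilibrium that is perfect. A strategy is strictly positive if it assigns strictly positive probability to each non-empty open set; a profile is strictly positive if each of its strategies is. $\sigma\in\Delta$ is a weak perfect equilibrium if there are a sequence $(\sigma^k)_{k\ge1}$ of strictly positive strategy profiles and a sequence $(\kappa^k)_{k\ge1}$ of strategy profiles such that $\kappa^k$ is a best response to $\sigma^k$ for each $k$, and $d_P(\sigma^k,\sigma)\to0$ and $d_P(\kappa^k,\sigma)\to0$ as $k\to\infty$. *)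

theory Defs
  imports "HOL-Probability.Probability"
begin

definition borel_of :: "'a topology \<Rightarrow> 'a measure" where
  "borel_of X = sigma (topspace X) {U. openin X U}"

definition directed_set :: "'i set \<Rightarrow> ('i \<Rightarrow> 'i \<Rightarrow> bool) \<Rightarrow> bool" where
  "directed_set I le \<longleftrightarrow>
     I \<noteq> {} \<and> reflp_on I le \<and> transp_on I le \<and>
     (\<forall>\<alpha>\<in>I. \<forall>\<beta>\<in>I. \<exists>\<gamma>\<in>I. le \<alpha> \<gamma> \<and> le \<beta> \<gamma>) \<and>
     (\<forall>\<alpha>\<in>I. \<exists>\<beta>\<in>I. le \<alpha> \<beta> \<and> \<beta> \<noteq> \<alpha>)"

definition net_filter :: "'i set \<Rightarrow> ('i \<Rightarrow> 'i \<Rightarrow> bool) \<Rightarrow> 'i filter" where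
  "net_filter I le = (INF \<alpha>\<in>I. principal {\<beta>\<in>I. le \<alpha> \<beta>})"

lemma eventually_net_filter:
  assumes "directed_set I le"
  shows "eventually P (net_filter I le) \<longleftrightarrow> (\<exists>\<alpha>\<in>I. \<forall>\<beta>\<in>I. le \<alpha> \<beta> \<longrightarrow> P \<beta>)"
proof -
  let ?F = "\<lambda>\<alpha>. principal {\<beta>\<in>I. le \<alpha> \<beta>}"
  have "\<exists>\<gamma>\<in>I. ?F \<gamma> \<le> inf (?F \<alpha>) (?F \<beta>)" if "\<alpha> \<in> I" "\<beta> \<in> I" for \<alpha> \<beta>
  proof -
    obtain \<gamma> where \<gamma>: "\<gamma> \<in> I" "le \<alpha> \<gamma>" "le \<beta> \<gamma>"
      using assms \<open>\<alpha> \<in> I\<close> \<open>\<beta> \<in> I\<close> unfolding directed_set_def by meson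
    have tr: "transp_on I le"
      using assms by (simp add: directed_set_def)
    have "le \<alpha> \<delta> \<and> le \<beta> \<delta>" if "\<delta> \<in> I" "le \<gamma> \<delta>" for \<delta>
      using transp_onD[OF tr \<open>\<alpha> \<in> I\<close> \<gamma>(1) \<open>\<delta> \<in> I\<close> \<gamma>(2) \<open>le \<gamma> \<delta>\<close>]
        transp_onD[OF tr \<open>\<beta> \<in> I\<close> \<gamma>(1) \<open>\<delta> \<in> I\<close> \<gamma>(3) \<open>le \<gamma> \<delta>\<close>] by simp
    then have "{\<delta>\<in>I. le \<gamma> \<delta>} \<subseteq> {\<delta>\<in>I. le \<alpha> \<delta>} \<inter> {\<delta>\<in>I. le \<beta> \<delta>}"
      by blast
    then show ?thesis
      using \<gamma>(1) by (intro bexI[of _ \<gamma>]) simp_all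
  qed
  moreover have "I \<noteq> {}"
    using assms by (simp add: directed_set_def)
  ultimately have "eventually P (net_filter I le) \<longleftrightarrow> (\<exists>\<alpha>\<in>I. eventually P (?F \<alpha>))"
    unfolding net_filter_def by (intro eventually_INF_base) blast+
  then show ?thesis
    unfolding eventually_principal by blast
qed

text \<open>
  The players are \<open>{1..n}\<close>. The strategy spaces \<open>A i\<close> are subsets of one ambient type and
  carry their own metrics \<open>d i\<close>; no structure of the ambient type is used.
\<close>

locale strategic_form_game =
  fixes n :: nat
    and A :: "nat \<Rightarrow> 'a set"
    and d :: "nat \<Rightarrow> 'a \<Rightarrow> 'a \<Rightarrow> real"
    and u :: "nat \<Rightarrow> (nat \<Rightarrow> 'a) \<Rightarrow> real"
  assumes players_nonempty: "n \<ge> 1"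
    and strategies_metric: "\<And>i. i \<in> {1..n} \<Longrightarrow> Metric_space (A i) (d i)"
    and strategies_compact:
      "\<And>i. i \<in> {1..n} \<Longrightarrow> compact_space (Metric_space.mtopology (A i) (d i))"
    and strategies_nonempty: "\<And>i. i \<in> {1..n} \<Longrightarrow> A i \<noteq> {}"
    and payoff_continuous:
      "\<And>i. i \<in> {1..n} \<Longrightarrow>
         continuous_map (product_topology (\<lambda>j. Metric_space.mtopology (A j) (d j)) {1..n})
           euclideanreal (u i)"
begin

definition strategy_topology :: "nat \<Rightarrow> 'a topology" where
  "strategy_topology i = Metric_space.mtopology (A i) (d i)"

definition profile_topology :: "(nat \<Rightarrow> 'a) topology" where
  "profile_topology = product_topology strategy_topology {1..n}"

definition mixed_strategies :: "nat \<Rightarrow> 'a measure set" where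
  "mixed_strategies i = {\<mu>. prob_space \<mu> \<and> sets \<mu> = sets (borel_of (strategy_topology i))}"

definition mixed_profiles :: "(nat \<Rightarrow> 'a measure) set" where
  "mixed_profiles = (\<Pi>\<^sub>E i\<in>{1..n}. mixed_strategies i)"

definition profile_measure :: "(nat \<Rightarrow> 'a measure) \<Rightarrow> (nat \<Rightarrow> 'a) measure" where
  "profile_measure \<sigma> = PiM {1..n} \<sigma>"

definition expected_payoff :: "nat \<Rightarrow> (nat \<Rightarrow> 'a measure) \<Rightarrow> real" where
  "expected_payoff i \<sigma> = (\<integral>a. u i a \<partial>profile_measure \<sigma>)"

definition best_response_strategy ::
    "nat \<Rightarrow> 'a measure \<Rightarrow> (nat \<Rightarrow> 'a measure) \<Rightarrow> bool" where
  "best_response_strategy i \<tau> \<sigma> \<longleftrightarrow>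
     \<tau> \<in> mixed_strategies i \<and>
     (\<forall>\<tau>'\<in>mixed_strategies i. expected_payoff i (\<sigma>(i := \<tau>)) \<ge> expected_payoff i (\<sigma>(i := \<tau>')))"

definition best_response :: "(nat \<Rightarrow> 'a measure) \<Rightarrow> (nat \<Rightarrow> 'a measure) \<Rightarrow> bool" where
  "best_response \<tau> \<sigma> \<longleftrightarrow>
     \<tau> \<in> mixed_profiles \<and> (\<forall>i\<in>{1..n}. best_response_strategy i (\<tau> i) \<sigma>)"

definition nash_equilibrium :: "(nat \<Rightarrow> 'a measure) \<Rightarrow> bool" where
  "nash_equilibrium \<sigma> \<longleftrightarrow> \<sigma> \<in> mixed_profiles \<and> best_response \<sigma> \<sigma>"

definition strategy_carrier :: "nat \<Rightarrow> 'a measure \<Rightarrow> 'a set set" where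
  "strategy_carrier i \<mu> = {E \<in> sets (borel_of (strategy_topology i)). measure \<mu> E > 0}"

definition profile_carrier :: "(nat \<Rightarrow> 'a measure) \<Rightarrow> (nat \<Rightarrow> 'a set) set" where
  "profile_carrier \<sigma> = (\<Pi>\<^sub>E i\<in>{1..n}. strategy_carrier i (\<sigma> i))"

definition carriers :: "(nat \<Rightarrow> 'a set) set set" where
  "carriers = profile_carrier ` mixed_profiles"

definition completely_mixed ::
    "'i set \<Rightarrow> ('i \<Rightarrow> 'i \<Rightarrow> bool) \<Rightarrow> ('i \<Rightarrow> nat \<Rightarrow> 'a measure) \<Rightarrow> bool" where
  "completely_mixed I le s \<longleftrightarrow>
     (\<forall>C\<in>carriers. \<exists>\<alpha>\<in>I. \<forall>\<beta>\<in>I. le \<alpha> \<beta> \<longrightarrow> C \<subseteq> profile_carrier (s \<beta>))"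

text \<open>
  Weak convergence of profiles is weak convergence of their product measures. All continuous
  functions are bounded here, since the space of pure profiles is compact.
\<close>

definition converges_weakly ::
    "('i \<Rightarrow> nat \<Rightarrow> 'a measure) \<Rightarrow> (nat \<Rightarrow> 'a measure) \<Rightarrow> 'i filter \<Rightarrow> bool" where
  "converges_weakly s \<sigma> F \<longleftrightarrow>
     (\<forall>f. continuous_map profile_topology euclideanreal f \<longrightarrow>
        ((\<lambda>\<alpha>. \<integral>a. f a \<partial>profile_measure (s \<alpha>)) \<longlongrightarrow> (\<integral>a. f a \<partial>profile_measure \<sigma>)) F)"

text \<open>
  A definition cannot quantify existentially over the type of a net's index set, so that type
  is passed as an argument. A theorem that assumes \<open>perfect TYPE('i) \<sigma>\<close> for a type variable
  \<open>'i\<close> covers nets over arbitrary directed sets.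
\<close>

definition perfect :: "'i itself \<Rightarrow> (nat \<Rightarrow> 'a measure) \<Rightarrow> bool" where
  "perfect ty \<sigma> \<longleftrightarrow>
     \<sigma> \<in> mixed_profiles \<and>
     (\<exists>(I :: 'i set) le s k.
        directed_set I le \<and>
        s \<in> I \<rightarrow> mixed_profiles \<and> k \<in> I \<rightarrow> mixed_profiles \<and>
        completely_mixed I le s \<and>
        converges_weakly s \<sigma> (net_filter I le) \<and>
        converges_weakly k \<sigma> (net_filter I le) \<and>
        (\<forall>\<alpha>\<in>I. best_response (k \<alpha>) (s \<alpha>)))"

definition perfect_equilibrium :: "'i itself \<Rightarrow> (nat \<Rightarrow> 'a measure) \<Rightarrow> bool" where
  "perfect_equilibrium ty \<sigma> \<longleftrightarrow> nash_equilibrium \<sigma> \<and> perfect ty \<sigma>"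

definition profile_dist :: "(nat \<Rightarrow> 'a) \<Rightarrow> (nat \<Rightarrow> 'a) \<Rightarrow> real" where
  "profile_dist a b = (MAX i\<in>{1..n}. d i (a i) (b i))"

text \<open>
  The distance to a set is taken in the extended reals, so that the distance to the empty
  set is infinite and the empty set has empty neighbourhoods.
\<close>

definition neighbourhood :: "(nat \<Rightarrow> 'a) set \<Rightarrow> real \<Rightarrow> (nat \<Rightarrow> 'a) set" where
  "neighbourhood B \<epsilon> =
     {a \<in> (\<Pi>\<^sub>E i\<in>{1..n}. A i). (INF b\<in>B. ereal (profile_dist a b)) < ereal \<epsilon>}"

definition prohorov_dist :: "(nat \<Rightarrow> 'a measure) \<Rightarrow> (nat \<Rightarrow> 'a measure) \<Rightarrow> real" where
  "prohorov_dist \<sigma> \<tau> =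
     Inf {\<epsilon>. \<epsilon> > 0 \<and>
       (\<forall>B\<in>sets (borel_of profile_topology).
          measure (profile_measure \<sigma>) B \<le> measure (profile_measure \<tau>) (neighbourhood B \<epsilon>) + \<epsilon> \<and>
          measure (profile_measure \<tau>) B \<le> measure (profile_measure \<sigma>) (neighbourhood B \<epsilon>) + \<epsilon>)}"

definition strictly_positive_strategy :: "nat \<Rightarrow> 'a measure \<Rightarrow> bool" where
  "strictly_positive_strategy i \<mu> \<longleftrightarrow>
     (\<forall>U. openin (strategy_topology i) U \<and> U \<noteq> {} \<longrightarrow> measure \<mu> U > 0)"

definition strictly_positive :: "(nat \<Rightarrow> 'a measure) \<Rightarrow> bool" where
  "strictly_positive \<sigma> \<longleftrightarrow> (\<forall>i\<in>{1..n}. strictly_positive_strategy i (\<sigma> i))"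

definition weak_perfect_equilibrium :: "(nat \<Rightarrow> 'a measure) \<Rightarrow> bool" where
  "weak_perfect_equilibrium \<sigma> \<longleftrightarrow>
     \<sigma> \<in> mixed_profiles \<and>
     (\<exists>s k :: nat \<Rightarrow> nat \<Rightarrow> 'a measure.
        (\<forall>m\<ge>1. s m \<in> mixed_profiles \<and> strictly_positive (s m) \<and>
                k m \<in> mixed_profiles \<and> best_response (k m) (s m)) \<and>
        (\<lambda>m. prohorov_dist (s m) \<sigma>) \<longlonglongrightarrow> 0 \<and>
        (\<lambda>m. prohorov_dist (k m) \<sigma>) \<longlonglongrightarrow> 0)"

end

end

theory Submission imports Defs begin

text \<open>
  The carrier of a strictly positive profile (which exists by separability) is eventually contained
  in the carriers of a completely mixed net, so the net itself is eventually strictly positive.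
  On the compact metric space of pure profiles, weak convergence of a net implies convergence in
  the Prohorov distance. Hence for every \<open>m\<close> some index has a strictly positive profile, and both
  it and its best response lie within Prohorov distance \<open>1/m\<close> of the limit; these indices need not
  increase, since a weak perfect equilibrium only asks for sequences.
\<close>

section \<open>Borel sigma-algebras of abstract topologies\<close>

lemma space_borel_of [simp]: "space (borel_of X) = topspace X"
  by (simp add: borel_of_def space_measure_of_conv)

lemma sets_borel_of: "sets (borel_of X) = sigma_sets (topspace X) {U. openin X U}"
  unfolding borel_of_def by (intro sets_measure_of) (auto dest: openin_subset)

lemma openin_borel_of: "openin X U \<Longrightarrow> U \<in> sets (borel_of X)"
  by (simp add: sets_borel_of sigma_sets.Basic)

context strategic_form_game
begin

section \<open>Boxes in the space of pure profiles\<close>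

abbreviation pure_profiles :: "(nat \<Rightarrow> 'a) set" where
  "pure_profiles \<equiv> \<Pi>\<^sub>E i\<in>{1..n}. A i"

text \<open>For a pure profile \<open>x\<close> this is the open ball of radius \<open>r\<close> in
  the maximum metric \<open>profile_dist\<close>. The product form makes it at once open in the
  product topology and measurable for the product measures.\<close>

definition profile_box :: "(nat \<Rightarrow> 'a) \<Rightarrow> real \<Rightarrow> (nat \<Rightarrow> 'a) set" where
  "profile_box x r = (\<Pi>\<^sub>E i\<in>{1..n}. Metric_space.mball (A i) (d i) (x i) r)"

lemma topspace_strategy_topology:
  "i \<in> {1..n} \<Longrightarrow> topspace (strategy_topology i) = A i"
  by (simp add: strategy_topology_def Metric_space.topspace_mtopology strategies_metric)

lemma topspace_profile_topology: "topspace profile_topology = pure_profiles"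
  unfolding profile_topology_def topspace_product_topology
  by (rule PiE_cong) (use topspace_strategy_topology in auto)

lemma openin_ball:
  "i \<in> {1..n} \<Longrightarrow> openin (strategy_topology i) (Metric_space.mball (A i) (d i) x r)"
  by (simp add: strategy_topology_def Metric_space.openin_mball strategies_metric)

lemma mem_ball:
  "i \<in> {1..n} \<Longrightarrow> y \<in> Metric_space.mball (A i) (d i) x r \<longleftrightarrow> x \<in> A i \<and> y \<in> A i \<and> d i x y < r"
  by (simp add: Metric_space.in_mball strategies_metric)

lemma mem_box:
  assumes "x \<in> pure_profiles" "a \<in> pure_profiles"
  shows "a \<in> profile_box x r \<longleftrightarrow> (\<forall>i\<in>{1..n}. d i (x i) (a i) < r)"
  using assms by (auto simp: profile_box_def PiE_iff mem_ball)

lemma openin_box: "openin profile_topology (profile_box x r)"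
  unfolding profile_box_def profile_topology_def by (simp add: openin_PiE openin_ball)

lemma box_subset: "profile_box x r \<subseteq> pure_profiles"
  using openin_subset[OF openin_box] by (simp add: topspace_profile_topology)

lemma strategy_finite_net:
  assumes "i \<in> {1..n}" "r > 0"
  obtains K where "finite K" "K \<subseteq> A i" "\<And>y. y \<in> A i \<Longrightarrow> \<exists>x\<in>K. d i x y < r"
proof -
  interpret Metric_space "A i" "d i" using strategies_metric assms(1) .
  have "mtotally_bounded (A i)"
    using strategies_compact[OF assms(1)] by (simp add: compact_space_eq_mcomplete_mtotally_bounded)
  then have "\<exists>K. finite K \<and> K \<subseteq> A i \<and> A i \<subseteq> (\<Union>x\<in>K. mball x r)"
    unfolding mtotally_bounded_def using assms(2) by simp
  then obtain K where K: "finite K" "K \<subseteq> A i" "A i \<subseteq> (\<Union>x\<in>K. mball x r)"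
    by (elim exE conjE)
  show ?thesis
  proof (rule that[OF K(1,2)])
    fix y assume "y \<in> A i"
    then obtain x where "x \<in> K" "y \<in> mball x r"
      using subsetD[OF K(3)] by (elim UN_E[rotated]) simp
    then show "\<exists>x\<in>K. d i x y < r" by (intro bexI[of _ x]) simp_all
  qed
qed

text \<open>Each compact factor is totally bounded, and in the maximum metric the product of finite
  nets of the factors is a net of the product with the same radius.\<close>

lemma profile_finite_net:
  assumes "r > 0"
  obtains K where "finite K" "K \<subseteq> pure_profiles"
    "\<And>a. a \<in> pure_profiles \<Longrightarrow> \<exists>x\<in>K. a \<in> profile_box x r"
proof -
  have "\<exists>K. finite K \<and> K \<subseteq> A i \<and> (\<forall>y\<in>A i. \<exists>x\<in>K. d i x y < r)" if "i \<in> {1..n}" for i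
    using strategy_finite_net[OF that assms] by metis
  then obtain K where K: "\<And>i. i \<in> {1..n} \<Longrightarrow> finite (K i)" "\<And>i. i \<in> {1..n} \<Longrightarrow> K i \<subseteq> A i"
    "\<And>i y. i \<in> {1..n} \<Longrightarrow> y \<in> A i \<Longrightarrow> \<exists>x\<in>K i. d i x y < r"
    by metis
  show ?thesis
  proof
    show "finite (PiE {1..n} K)" using K(1) by (intro finite_PiE) auto
    show sub: "PiE {1..n} K \<subseteq> pure_profiles" using K(2) by (intro PiE_mono)
    fix a assume a: "a \<in> pure_profiles"
    then have "\<exists>x\<in>K i. d i x (a i) < r" if "i \<in> {1..n}" for i
      using K(3) that by (auto simp: PiE_iff)
    then obtain x where x: "\<And>i. i \<in> {1..n} \<Longrightarrow> x i \<in> K i \<and> d i (x i) (a i) < r"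
      by metis
    then have "restrict x {1..n} \<in> PiE {1..n} K" by auto
    moreover have "a \<in> profile_box (restrict x {1..n}) r"
      using mem_box[OF subsetD[OF sub calculation] a] x by simp
    ultimately show "\<exists>x\<in>PiE {1..n} K. a \<in> profile_box x r" by blast
  qed
qed

text \<open>A basic open set of the product gives one radius per coordinate. There are finitely many
  players and at least one, so the smallest of these radii exists, is positive and serves all
  coordinates.\<close>

lemma openin_contains_box:
  assumes "openin profile_topology U" "a \<in> U"
  obtains r where "r > 0" "profile_box a r \<subseteq> U"
proof -
  obtain V where V: "\<And>i. i \<in> {1..n} \<Longrightarrow> openin (strategy_topology i) (V i)"
    "a \<in> PiE {1..n} V" "PiE {1..n} V \<subseteq> U"
    using assms unfolding profile_topology_def openin_product_topology_alt by metis
  have "\<exists>r>0. Metric_space.mball (A i) (d i) (a i) r \<subseteq> V i" if "i \<in> {1..n}" for i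
    using V(1)[OF that] V(2) that
    by (auto simp: strategy_topology_def Metric_space.openin_mtopology[OF strategies_metric[OF that]])
  then obtain r where r: "\<And>i. i \<in> {1..n} \<Longrightarrow> r i > 0"
    "\<And>i. i \<in> {1..n} \<Longrightarrow> Metric_space.mball (A i) (d i) (a i) (r i) \<subseteq> V i"
    by metis
  let ?r = "Min (r ` {1..n})"
  show ?thesis
  proof
    show "?r > 0" using r(1) players_nonempty by simp
    have "Metric_space.mball (A i) (d i) (a i) ?r \<subseteq> V i" if "i \<in> {1..n}" for i
    proof -
      have "?r \<le> r i" using that by simp
      then show ?thesis using r(2)[OF that] by (force simp: mem_ball[OF that])
    qed
    then have "profile_box a ?r \<subseteq> PiE {1..n} V"
      unfolding profile_box_def by (intro PiE_mono)
    then show "profile_box a ?r \<subseteq> U" using V(3) by blast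
  qed
qed

section \<open>Product measures and measurability of Borel sets\<close>

lemma mixed_profilesD:
  assumes "\<sigma> \<in> mixed_profiles" "i \<in> {1..n}"
  shows "prob_space (\<sigma> i)" "sets (\<sigma> i) = sets (borel_of (strategy_topology i))"
    "space (\<sigma> i) = A i"
proof -
  show "prob_space (\<sigma> i)" and *: "sets (\<sigma> i) = sets (borel_of (strategy_topology i))"
    using assms by (auto simp: mixed_profiles_def mixed_strategies_def PiE_iff)
  show "space (\<sigma> i) = A i"
    using sets_eq_imp_space_eq[OF *] topspace_strategy_topology[OF assms(2)] by simp
qed

lemma prob_space_profile_measure: "\<sigma> \<in> mixed_profiles \<Longrightarrow> prob_space (profile_measure \<sigma>)"
  unfolding profile_measure_def by (rule prob_space_PiM) (simp add: mixed_profilesD(1))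

lemma space_profile_measure: "\<sigma> \<in> mixed_profiles \<Longrightarrow> space (profile_measure \<sigma>) = pure_profiles"
  unfolding profile_measure_def space_PiM by (rule PiE_cong) (simp add: mixed_profilesD(3))

text \<open>
  The product sigma-algebra contains every open set of the product because an open set is the
  countable union of the boxes it contains with radius \<open>1/m\<close> and centre in a finite \<open>1/m\<close>-net.
\<close>

lemma openin_profile_measurable:
  assumes U: "openin profile_topology U" and \<sigma>: "\<sigma> \<in> mixed_profiles"
  shows "U \<in> sets (profile_measure \<sigma>)"
proof -
  have profile_box: "profile_box x r \<in> sets (profile_measure \<sigma>)" for x r
    unfolding profile_measure_def profile_box_def
    by (intro sets_PiM_I_finite) (simp_all add: mixed_profilesD[OF \<sigma>] openin_borel_of openin_ball)
  define r where "r m = inverse (real (Suc m))" for m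
  have r: "r m > 0" for m by (simp add: r_def)
  have "\<exists>K. finite K \<and> K \<subseteq> pure_profiles \<and> (\<forall>a\<in>pure_profiles. \<exists>x\<in>K. a \<in> profile_box x (r m))" for m
    using profile_finite_net[OF r] by metis
  then obtain K where K: "\<And>m. finite (K m)" "\<And>m. K m \<subseteq> pure_profiles"
    "\<And>m a. a \<in> pure_profiles \<Longrightarrow> \<exists>x\<in>K m. a \<in> profile_box x (r m)"
    by metis
  have "U = (\<Union>m. \<Union>x\<in>{x \<in> K m. profile_box x (r m) \<subseteq> U}. profile_box x (r m))" (is "_ = ?V")
  proof
    show "?V \<subseteq> U" by auto
    show "U \<subseteq> ?V"
    proof
      fix a assume a: "a \<in> U"
      then have aA: "a \<in> pure_profiles"
        using openin_subset[OF U] topspace_profile_topology by auto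
      obtain \<epsilon> where \<epsilon>: "\<epsilon> > 0" "profile_box a \<epsilon> \<subseteq> U" using openin_contains_box[OF U a] .
      \<comment> \<open>Points of a box of radius \<open>r m\<close> that contains \<open>a\<close>
        have distance less than \<open>2 * r m\<close> from \<open>a\<close>, so this choice keeps
        the whole box inside \<open>profile_box a \<epsilon>\<close>.\<close>
      obtain m where m: "r m < \<epsilon> / 2"
        using reals_Archimedean[of "\<epsilon> / 2"] \<epsilon>(1) by (auto simp: r_def)
      obtain x where x: "x \<in> K m" "a \<in> profile_box x (r m)" using K(3)[OF aA] by blast
      have xA: "x \<in> pure_profiles" using x(1) K(2) by blast
      have "b \<in> profile_box a \<epsilon>" if b: "b \<in> profile_box x (r m)" for b
      proof -
        have bA: "b \<in> pure_profiles" using b box_subset by blast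
        have "d i (a i) (b i) < \<epsilon>" if i: "i \<in> {1..n}" for i
        proof -
          interpret Metric_space "A i" "d i" using strategies_metric i .
          have "d i (a i) (b i) \<le> d i (x i) (a i) + d i (x i) (b i)"
            using i aA bA xA triangle[of "a i" "x i" "b i"] by (auto simp: PiE_iff commute)
          also have "\<dots> < r m + r m"
            using b x(2) i mem_box[OF xA aA] mem_box[OF xA bA] by (intro add_strict_mono) auto
          finally show ?thesis using m by linarith
        qed
        then show ?thesis using mem_box[OF aA bA] by blast
      qed
      then show "a \<in> ?V" using x \<epsilon>(2) by blast
    qed
  qed
  also have "\<dots> \<in> sets (profile_measure \<sigma>)"
    using K(1) profile_box by (intro sets.countable_UN sets.finite_UN image_subsetI) auto
  finally show ?thesis .
qed

text \<open>The Prohorov distance ranges over the Borel sets of the product topology, whereas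
  \<open>profile_measure\<close> lives on the product sigma-algebra. The inclusion guards against
  \<open>measure\<close> returning its default value 0 on a non-measurable set.\<close>

lemma sets_borel_of_profile_subset:
  assumes "\<sigma> \<in> mixed_profiles"
  shows "sets (borel_of profile_topology) \<subseteq> sets (profile_measure \<sigma>)"
  unfolding sets_borel_of topspace_profile_topology space_profile_measure[OF assms, symmetric]
  using openin_profile_measurable[OF _ assms] by (intro sets.sigma_sets_subset) auto

lemma continuous_map_profile_measurable:
  assumes f: "continuous_map profile_topology euclideanreal f" and \<sigma>: "\<sigma> \<in> mixed_profiles"
  shows "f \<in> borel_measurable (profile_measure \<sigma>)"
  unfolding borel_measurable_iff_greater
proof
  fix c
  have "openin profile_topology {a \<in> topspace profile_topology. f a \<in> {c<..}}"
    using f by (rule openin_continuous_map_preimage) simp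
  then show "{a \<in> space (profile_measure \<sigma>). c < f a} \<in> sets (profile_measure \<sigma>)"
    using openin_profile_measurable[OF _ \<sigma>]
    by (simp add: topspace_profile_topology space_profile_measure[OF \<sigma>])
qed

section \<open>Neighbourhoods and cut-off functions\<close>

text \<open>An infimum lies strictly below \<epsilon> iff some term does, which turns the
  extended-real distance into a union of open balls. For empty \<open>B\<close> both sides are
  empty. The union shows that neighbourhoods are open, hence measurable.\<close>

lemma neighbourhood_eq:
  assumes "B \<subseteq> pure_profiles"
  shows "neighbourhood B \<epsilon> = (\<Union>b\<in>B. profile_box b \<epsilon>)"
proof -
  have eq: "a \<in> neighbourhood B \<epsilon> \<longleftrightarrow> a \<in> (\<Union>b\<in>B. profile_box b \<epsilon>)" if a: "a \<in> pure_profiles" for a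
  proof -
    have "profile_dist a b < \<epsilon> \<longleftrightarrow> a \<in> profile_box b \<epsilon>" if "b \<in> B" for b
    proof -
      have b: "b \<in> pure_profiles" using that assms by blast
      have "profile_dist a b < \<epsilon> \<longleftrightarrow> (\<forall>i\<in>{1..n}. d i (a i) (b i) < \<epsilon>)"
        unfolding profile_dist_def using players_nonempty by (subst Max_less_iff) auto
      also have "\<dots> \<longleftrightarrow> (\<forall>i\<in>{1..n}. d i (b i) (a i) < \<epsilon>)"
        using Metric_space.commute[OF strategies_metric] by metis
      finally show ?thesis using mem_box[OF b a] by simp
    qed
    then show ?thesis using a by (auto simp: neighbourhood_def INF_less_iff)
  qed
  have N: "neighbourhood B \<epsilon> \<subseteq> pure_profiles"
    by (auto simp only: neighbourhood_def)
  have U: "(\<Union>b\<in>B. profile_box b \<epsilon>) \<subseteq> pure_profiles"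
    by (intro UN_least box_subset)
  show ?thesis
    using eq[OF subsetD[OF N]] eq[OF subsetD[OF U]] by (intro subset_antisym subsetI) iprover+
qed

lemma openin_neighbourhood:
  assumes "B \<subseteq> pure_profiles"
  shows "openin profile_topology (neighbourhood B \<epsilon>)"
  unfolding neighbourhood_eq[OF assms] by (rule openin_Union) (use openin_box in blast)

lemma continuous_map_strategy_dist:
  assumes "i \<in> {1..n}" "x \<in> A i"
  shows "continuous_map profile_topology euclideanreal (\<lambda>a. d i x (a i))"
proof -
  interpret Metric_space "A i" "d i" using strategies_metric assms(1) .
  have "continuous_map (strategy_topology i) euclideanreal (d i x)"
    using continuous_on_mdist[of x "metric (A i, d i)"] assms(2)
    by (simp add: strategy_topology_def mtopology_of mspace_metric mdist_metric)
  with continuous_map_compose[OF continuous_map_product_projection[OF assms(1), of strategy_topology]]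
  show ?thesis by (simp add: profile_topology_def comp_def)
qed

text \<open>
  If \<open>K\<close> is a finite \<open>\<epsilon>/3\<close>-net, then the sets \<open>B\<close> fall into the finitely many classes given by the
  set of points of \<open>K\<close> that are \<open>\<epsilon>/3\<close>-close to \<open>B\<close>, and one cut-off function serves a whole class.
  This finiteness makes weak convergence uniform over all Borel sets.
\<close>

lemma finitely_many_cutoffs:
  assumes "\<epsilon> > 0"
  obtains F where "finite F"
    "\<And>f. f \<in> F \<Longrightarrow> continuous_map profile_topology euclideanreal f"
    "\<And>f a. f \<in> F \<Longrightarrow> 0 \<le> f a \<and> f a \<le> 1"
    "\<And>B. B \<subseteq> pure_profiles \<Longrightarrow> \<exists>f\<in>F. (\<forall>a\<in>B. f a = 1) \<and>
       (\<forall>a\<in>pure_profiles. f a > 0 \<longrightarrow> a \<in> neighbourhood B \<epsilon>)"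
proof -
  \<comment> \<open>A third of \<epsilon>, because a point of \<open>B\<close> will be within
    \<delta> of a net point and the support of the bump function there reaches out to
    \<open>2 * \<delta>\<close>.\<close>
  define \<delta> where "\<delta> = \<epsilon> / 3"
  have \<delta>: "\<delta> > 0" using assms by (simp add: \<delta>_def)
  obtain K where K: "finite K" "K \<subseteq> pure_profiles"
    "\<And>a. a \<in> pure_profiles \<Longrightarrow> \<exists>x\<in>K. a \<in> profile_box x \<delta>"
    using profile_finite_net[OF \<delta>] by metis
  \<comment> \<open>\<open>g x\<close> is a bump at \<open>x\<close>: each factor is 1 up to
    distance \<delta>, falls linearly and vanishes from distance \<open>2 * \<delta>\<close>
    on.\<close>
  define g where "g x a = (\<Prod>i\<in>{1..n}. max 0 (min 1 (2 - d i (x i) (a i) / \<delta>)))" for x a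
  \<comment> \<open>The cap at 1 bounds the sum of overlapping bumps; \<open>S\<close> ranges over
    the subsets of the finite net, so only finitely many functions arise.\<close>
  define f where "f S a = min 1 (\<Sum>x\<in>S. g x a)" for S a
  have g_nonneg: "g x a \<ge> 0" for x a
    unfolding g_def by (intro prod_nonneg) auto
  have g_one: "g x a = 1" if "\<And>i. i \<in> {1..n} \<Longrightarrow> d i (x i) (a i) < \<delta>" for x a
    unfolding g_def
  proof (intro prod.neutral ballI)
    fix i assume "i \<in> {1..n}"
    then have "d i (x i) (a i) / \<delta> < 1" using that \<delta> by simp
    then show "max 0 (min 1 (2 - d i (x i) (a i) / \<delta>)) = 1" by simp
  qed
  have g_pos: "d i (x i) (a i) < 2 * \<delta>" if "g x a \<noteq> 0" "i \<in> {1..n}" for x a i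
  proof -
    have "max 0 (min 1 (2 - d i (x i) (a i) / \<delta>)) \<noteq> 0"
      using that by (auto simp: g_def)
    then have "d i (x i) (a i) / \<delta> < 2" by (auto simp: max_def split: if_splits)
    then show ?thesis using \<delta> by (simp add: field_simps)
  qed
  show ?thesis
  proof
    show "finite (f ` Pow K)" using K(1) by simp
  next
    fix h assume "h \<in> f ` Pow K"
    then obtain S where S: "S \<subseteq> K" "h = f S" by auto
    have "continuous_map profile_topology euclideanreal (g x)" if "x \<in> S" for x
    proof -
      have "x i \<in> A i" if "i \<in> {1..n}" for i
        using \<open>x \<in> S\<close> S(1) K(2) that by (auto simp: PiE_iff)
      then show ?thesis
        unfolding g_def using \<delta>
        by (intro continuous_map_prod continuous_map_real_max continuous_map_real_min
            continuous_map_diff continuous_map_real_divide continuous_map_strategy_dist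
            continuous_map_canonical_const) auto
    qed
    then show "continuous_map profile_topology euclideanreal h"
      unfolding S(2) f_def using finite_subset[OF S(1) K(1)]
      by (intro continuous_map_real_min continuous_map_sum continuous_map_canonical_const)
    show "0 \<le> h a \<and> h a \<le> 1" for a
      by (simp add: S(2) f_def sum_nonneg g_nonneg)
  next
    fix B assume B: "B \<subseteq> pure_profiles"
    define S where "S = {x \<in> K. \<exists>b\<in>B. b \<in> profile_box x \<delta>}"
    have fin: "finite S" using K(1) by (simp add: S_def)
    have one: "f S b = 1" if b: "b \<in> B" for b
    proof -
      have bA: "b \<in> pure_profiles" using b B by blast
      obtain x where x: "x \<in> K" "b \<in> profile_box x \<delta>" using K(3)[OF bA] by blast
      have xA: "x \<in> pure_profiles" using x(1) K(2) by blast
      have "x \<in> S" using x b by (auto simp: S_def)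
      have "g x b = 1"
        using x(2) mem_box[OF xA bA] by (intro g_one) auto
      then have "(\<Sum>x\<in>S. g x b) \<ge> 1"
        using member_le_sum[of x S "\<lambda>x. g x b"] \<open>x \<in> S\<close> fin g_nonneg by auto
      then show ?thesis by (simp add: f_def)
    qed
    have pos: "a \<in> neighbourhood B \<epsilon>" if aA: "a \<in> pure_profiles" and f: "f S a > 0" for a
    proof -
      \<comment> \<open>A positive value at \<open>a\<close> forces some bump with centre in
        \<open>S\<close> to be nonzero there; by the choice of \<open>S\<close> that centre is also
        close to a point of \<open>B\<close>.\<close>
      have "(\<Sum>x\<in>S. g x a) \<noteq> 0" using f by (auto simp: f_def)
      then obtain x where x: "x \<in> S" "g x a \<noteq> 0" by (meson sum.neutral)
      then obtain b where b: "b \<in> B" "b \<in> profile_box x \<delta>" by (auto simp: S_def)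
      have xA: "x \<in> pure_profiles" using x(1) K(2) by (auto simp: S_def)
      have bA: "b \<in> pure_profiles" using b B by blast
      have "d i (b i) (a i) < \<epsilon>" if i: "i \<in> {1..n}" for i
      proof -
        interpret Metric_space "A i" "d i" using strategies_metric i .
        have "d i (b i) (a i) \<le> d i (x i) (b i) + d i (x i) (a i)"
          using i aA bA xA triangle[of "b i" "x i" "a i"] by (auto simp: PiE_iff commute)
        also have "\<dots> < \<delta> + 2 * \<delta>"
          using b(2) i mem_box[OF xA bA] g_pos[OF x(2) i] by (intro add_strict_mono) auto
        finally show ?thesis by (simp add: \<delta>_def)
      qed
      then show ?thesis
        using mem_box[OF bA aA] b(1) unfolding neighbourhood_eq[OF B] by blast
    qed
    show "\<exists>h\<in>f ` Pow K. (\<forall>a\<in>B. h a = 1) \<and>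
        (\<forall>a\<in>pure_profiles. h a > 0 \<longrightarrow> a \<in> neighbourhood B \<epsilon>)"
      using one pos by (intro bexI[of _ "f S"]) (auto simp: S_def)
  qed
qed

text \<open>The function dominates the indicator of \<open>B\<close>. This is the lower half of a
  sandwich between a set and its neighbourhood.\<close>

lemma measure_le_integral_cutoff:
  assumes \<sigma>: "\<sigma> \<in> mixed_profiles" and B: "B \<in> sets (profile_measure \<sigma>)"
    and f: "continuous_map profile_topology euclideanreal f" "\<And>a. 0 \<le> f a \<and> f a \<le> 1"
    and one: "\<And>a. a \<in> B \<Longrightarrow> f a = 1"
  shows "measure (profile_measure \<sigma>) B \<le> (\<integral>a. f a \<partial>profile_measure \<sigma>)"
proof -
  interpret prob_space "profile_measure \<sigma>" using prob_space_profile_measure[OF \<sigma>] .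
  have "(\<integral>a. indicator B a \<partial>profile_measure \<sigma>) \<le> (\<integral>a. f a \<partial>profile_measure \<sigma>)"
    using f(2) one B continuous_map_profile_measurable[OF f(1) \<sigma>]
    by (intro integral_mono integrable_const_bound[where B = 1])
      (auto simp: indicator_def)
  then show ?thesis using B by simp
qed

text \<open>The function vanishes off \<open>B\<close> and is at most 1, so the indicator of
  \<open>B\<close> dominates it. In the application \<open>B\<close> is a neighbourhood.\<close>

lemma integral_cutoff_le_measure:
  assumes \<sigma>: "\<sigma> \<in> mixed_profiles" and B: "B \<in> sets (profile_measure \<sigma>)"
    and f: "continuous_map profile_topology euclideanreal f" "\<And>a. 0 \<le> f a \<and> f a \<le> 1"
    and pos: "\<And>a. a \<in> pure_profiles \<Longrightarrow> f a > 0 \<Longrightarrow> a \<in> B"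
  shows "(\<integral>a. f a \<partial>profile_measure \<sigma>) \<le> measure (profile_measure \<sigma>) B"
proof -
  interpret prob_space "profile_measure \<sigma>" using prob_space_profile_measure[OF \<sigma>] .
  have le: "f a \<le> indicator B a" if "a \<in> space (profile_measure \<sigma>)" for a
    using f(2)[of a] pos[of a] that
    by (cases "f a > 0") (auto simp: space_profile_measure[OF \<sigma>] indicator_def not_less)
  have "(\<integral>a. f a \<partial>profile_measure \<sigma>) \<le> (\<integral>a. indicator B a \<partial>profile_measure \<sigma>)"
    using f(2) le B continuous_map_profile_measurable[OF f(1) \<sigma>]
    by (intro integral_mono integrable_const_bound[where B = 1]) auto
  then show ?thesis using B by simp
qed

section \<open>Weak convergence implies Prohorov convergence\<close>

text \<open>One admissible \<epsilon> yields both bounds: it bounds the infimum from above, and it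
  makes the set nonempty, without which the real \<open>Inf\<close> would carry no information about
  its sign.\<close>

lemma prohorov_dist_bounds:
  assumes "\<epsilon> > 0"
    and "\<And>B. B \<in> sets (borel_of profile_topology) \<Longrightarrow>
      measure (profile_measure \<sigma>) B \<le> measure (profile_measure \<tau>) (neighbourhood B \<epsilon>) + \<epsilon> \<and>
      measure (profile_measure \<tau>) B \<le> measure (profile_measure \<sigma>) (neighbourhood B \<epsilon>) + \<epsilon>"
  shows "0 \<le> prohorov_dist \<sigma> \<tau>" "prohorov_dist \<sigma> \<tau> \<le> \<epsilon>"
proof -
  show "0 \<le> prohorov_dist \<sigma> \<tau>"
    unfolding prohorov_dist_def using assms by (intro cInf_greatest) auto
  show "prohorov_dist \<sigma> \<tau> \<le> \<epsilon>"
    unfolding prohorov_dist_def using assms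
    by (intro cInf_lower bdd_belowI[of _ 0]) auto
qed

text \<open>Finitely many cut-off integrals are eventually all within \<epsilon> of their limits.
  For each Borel set one of these functions fits between the set and its \<epsilon>-neighbourhood,
  and the two integrals differ by less than \<epsilon>.\<close>

lemma converges_weakly_prohorov:
  assumes conv: "converges_weakly s \<sigma> G" and \<sigma>: "\<sigma> \<in> mixed_profiles"
    and s: "eventually (\<lambda>\<alpha>. s \<alpha> \<in> mixed_profiles) G" and "\<epsilon> > 0"
  shows "eventually (\<lambda>\<alpha>. 0 \<le> prohorov_dist (s \<alpha>) \<sigma> \<and> prohorov_dist (s \<alpha>) \<sigma> \<le> \<epsilon>) G"
proof -
  obtain F where F: "finite F"
    "\<And>f. f \<in> F \<Longrightarrow> continuous_map profile_topology euclideanreal f"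
    "\<And>f a. f \<in> F \<Longrightarrow> 0 \<le> f a \<and> f a \<le> 1"
    "\<And>B. B \<subseteq> pure_profiles \<Longrightarrow> \<exists>f\<in>F. (\<forall>a\<in>B. f a = 1) \<and>
       (\<forall>a\<in>pure_profiles. f a > 0 \<longrightarrow> a \<in> neighbourhood B \<epsilon>)"
    using finitely_many_cutoffs[OF \<open>\<epsilon> > 0\<close>] by metis
  have "eventually (\<lambda>\<alpha>. \<forall>f\<in>F. dist (\<integral>a. f a \<partial>profile_measure (s \<alpha>)) (\<integral>a. f a \<partial>profile_measure \<sigma>) < \<epsilon>) G"
    using conv F(2) \<open>\<epsilon> > 0\<close> unfolding converges_weakly_def
    by (intro eventually_ball_finite[OF F(1)]) (auto intro: tendstoD)
  with s show ?thesis
  proof eventually_elim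
    case (elim \<alpha>)
    \<comment> \<open>Stated for two arbitrary profiles, since it is used with the roles of
      \<open>s \<alpha>\<close> and \<sigma> exchanged for the two inequalities.\<close>
    have *: "measure (profile_measure \<tau>) B \<le> measure (profile_measure \<rho>) (neighbourhood B \<epsilon>) + \<epsilon>"
      if \<tau>: "\<tau> \<in> mixed_profiles" and \<rho>: "\<rho> \<in> mixed_profiles"
        and close: "\<forall>f\<in>F. \<bar>(\<integral>a. f a \<partial>profile_measure \<tau>) - (\<integral>a. f a \<partial>profile_measure \<rho>)\<bar> < \<epsilon>"
        and B: "B \<in> sets (borel_of profile_topology)" for \<tau> \<rho> B
    proof -
      have "B \<subseteq> pure_profiles"
        using sets.sets_into_space[OF B] by (simp add: topspace_profile_topology)
      then obtain f where f: "f \<in> F" "\<And>a. a \<in> B \<Longrightarrow> f a = 1"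
        "\<And>a. a \<in> pure_profiles \<Longrightarrow> f a > 0 \<Longrightarrow> a \<in> neighbourhood B \<epsilon>"
        using F(4) by meson
      have "measure (profile_measure \<tau>) B \<le> (\<integral>a. f a \<partial>profile_measure \<tau>)"
        using f F(2,3) B sets_borel_of_profile_subset[OF \<tau>]
        by (intro measure_le_integral_cutoff[OF \<tau>]) auto
      moreover have "(\<integral>a. f a \<partial>profile_measure \<rho>) \<le> measure (profile_measure \<rho>) (neighbourhood B \<epsilon>)"
        using f F(2,3) openin_neighbourhood[OF \<open>B \<subseteq> pure_profiles\<close>]
        by (intro integral_cutoff_le_measure[OF \<rho>] openin_profile_measurable[OF _ \<rho>]) auto
      ultimately show ?thesis using bspec[OF close f(1)] by linarith
    qed
    then show ?case
      using elim \<sigma> \<open>\<epsilon> > 0\<close>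
      by (intro conjI prohorov_dist_bounds) (auto simp: dist_real_def abs_minus_commute)
  qed
qed

section \<open>Strictly positive profiles and carriers\<close>

text \<open>Finite nets of radii tending to 0 form a countable dense set. The geometric distribution
  gives every natural number positive mass, so its image under an enumeration of that set charges
  every nonempty open set.\<close>

lemma strictly_positive_strategy_exists:
  assumes i: "i \<in> {1..n}"
  obtains \<mu> where "\<mu> \<in> mixed_strategies i" "strictly_positive_strategy i \<mu>"
proof -
  interpret Metric_space "A i" "d i" using strategies_metric i .
  have "\<exists>K. finite K \<and> K \<subseteq> A i \<and> (\<forall>y\<in>A i. \<exists>x\<in>K. d i x y < inverse (real (Suc m)))" for m
  proof -
    have "inverse (real (Suc m)) > 0" by simp
    from strategy_finite_net[OF i this] show ?thesis by metis
  qed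
  then obtain K where K: "\<And>m. finite (K m)" "\<And>m. K m \<subseteq> A i"
    "\<And>m y. y \<in> A i \<Longrightarrow> \<exists>x\<in>K m. d i x y < inverse (real (Suc m))"
    by metis
  let ?D = "\<Union>m. K m"
  have "countable ?D" using K(1) by (auto intro: countable_finite)
  moreover have ne: "?D \<noteq> {}"
  proof -
    obtain y where "y \<in> A i" using strategies_nonempty[OF i] by blast
    then show ?thesis using K(3)[of y 0] by blast
  qed
  \<comment> \<open>Only surjectivity onto the dense set matters: if the set is finite, the
    enumeration repeats points, which merely adds up their masses.\<close>
  ultimately have range: "range (from_nat_into ?D) = ?D"
    by (simp add: range_from_nat_into)
  let ?p = "measure_pmf (geometric_pmf (1/2))"
  let ?\<mu> = "distr ?p (borel_of (strategy_topology i)) (from_nat_into ?D)"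
  have meas: "from_nat_into ?D \<in> measurable ?p (borel_of (strategy_topology i))"
    using range K(2) by (auto simp: topspace_strategy_topology[OF i])
  show ?thesis
  proof
    show "?\<mu> \<in> mixed_strategies i"
      using measure_pmf.prob_space_distr[OF meas] by (simp add: mixed_strategies_def)
    show "strictly_positive_strategy i ?\<mu>"
      unfolding strictly_positive_strategy_def
    proof (intro allI impI, elim conjE)
      fix U assume U: "openin (strategy_topology i) U" "U \<noteq> {}"
      then obtain y where y: "y \<in> U" by blast
      have yA: "y \<in> A i"
        using y openin_subset[OF U(1)] topspace_strategy_topology[OF i] by auto
      obtain r where r: "r > 0" "mball y r \<subseteq> U"
        using U(1) y by (auto simp: strategy_topology_def openin_mtopology)
      obtain m where m: "inverse (real (Suc m)) < r" using reals_Archimedean r(1) by blast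
      obtain x where x: "x \<in> K m" "d i x y < inverse (real (Suc m))" using K(3)[OF yA] by blast
      have "x \<in> mball y r"
        using x K(2)[of m] yA m by (auto simp: commute)
      with r have "x \<in> U" by blast
      moreover have "x \<in> range (from_nat_into ?D)" unfolding range using x(1) by blast
      then obtain j where "from_nat_into ?D j = x" by blast
      ultimately have "j \<in> from_nat_into ?D -` U" by simp
      then have "measure ?p (from_nat_into ?D -` U) > 0"
        by (intro measure_pmf_posI[of j]) (simp_all add: set_pmf_geometric)
      then show "measure ?\<mu> U > 0"
        using meas openin_borel_of[OF U(1)] by (subst measure_distr) simp_all
    qed
  qed
qed

lemma strictly_positive_profile_exists:
  obtains \<tau> where "\<tau> \<in> mixed_profiles" "strictly_positive \<tau>"
proof -
  have "\<exists>\<mu>. \<mu> \<in> mixed_strategies i \<and> strictly_positive_strategy i \<mu>" if "i \<in> {1..n}" for i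
    using strictly_positive_strategy_exists[OF that] by metis
  then obtain \<mu> where "\<And>i. i \<in> {1..n} \<Longrightarrow> \<mu> i \<in> mixed_strategies i \<and> strictly_positive_strategy i (\<mu> i)"
    by metis
  then show ?thesis
    using that[of "restrict \<mu> {1..n}"] by (auto simp: mixed_profiles_def strictly_positive_def)
qed

text \<open>Every nonempty open set lies in the carrier of a strictly positive strategy. An
  inclusion of products of carriers passes to the factors because the other coordinates can be
  filled with the whole spaces \<open>A j\<close>.\<close>

lemma strictly_positive_if_carrier_subset:
  assumes \<tau>: "\<tau> \<in> mixed_profiles" "strictly_positive \<tau>"
    and sub: "profile_carrier \<tau> \<subseteq> profile_carrier \<rho>"
  shows "strictly_positive \<rho>"
proof -
  have *: "U \<in> strategy_carrier i (\<tau> i)"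
    if "i \<in> {1..n}" "openin (strategy_topology i) U" "U \<noteq> {}" for i U
    using that \<tau>(2)
    by (auto simp: strategy_carrier_def strictly_positive_def strictly_positive_strategy_def
        openin_borel_of)
  have whole: "A i \<in> strategy_carrier i (\<tau> i)" if "i \<in> {1..n}" for i
    using *[OF that, of "A i"] strategies_nonempty[OF that] openin_topspace[of "strategy_topology i"]
    by (simp add: topspace_strategy_topology[OF that])
  have "measure (\<rho> i) U > 0"
    if i: "i \<in> {1..n}" and U: "openin (strategy_topology i) U" "U \<noteq> {}" for i U
  proof -
    have "(\<lambda>j\<in>{1..n}. if j = i then U else A j) \<in> profile_carrier \<tau>"
      using * whole i U by (auto simp: profile_carrier_def)
    then have "(\<lambda>j\<in>{1..n}. if j = i then U else A j) \<in> profile_carrier \<rho>"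
      using sub by blast
    then have "(\<lambda>j\<in>{1..n}. if j = i then U else A j) i \<in> strategy_carrier i (\<rho> i)"
      unfolding profile_carrier_def using i by (rule PiE_mem)
    then show ?thesis using i by (simp add: strategy_carrier_def)
  qed
  then show ?thesis
    by (auto simp: strictly_positive_def strictly_positive_strategy_def)
qed

section \<open>From the net to a sequence\<close>

theorem perfect_imp_weak_perfect_equilibrium:
  assumes "perfect TYPE('i) \<sigma>"
  shows "weak_perfect_equilibrium \<sigma>"
proof -
  obtain I :: "'i set" and le s k where \<sigma>: "\<sigma> \<in> mixed_profiles" and I: "directed_set I le"
    and s: "s \<in> I \<rightarrow> mixed_profiles" and k: "k \<in> I \<rightarrow> mixed_profiles"
    and mixed: "completely_mixed I le s"
    and conv: "converges_weakly s \<sigma> (net_filter I le)" "converges_weakly k \<sigma> (net_filter I le)"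
    and br: "\<And>\<alpha>. \<alpha> \<in> I \<Longrightarrow> best_response (k \<alpha>) (s \<alpha>)"
    using assms unfolding perfect_def by auto
  let ?G = "net_filter I le"
  have ev_I: "eventually (\<lambda>\<alpha>. \<alpha> \<in> I) ?G"
    using I by (auto simp: eventually_net_filter[OF I] directed_set_def)
  obtain \<tau> where \<tau>: "\<tau> \<in> mixed_profiles" "strictly_positive \<tau>"
    using strictly_positive_profile_exists .
  have ev_pos: "eventually (\<lambda>\<alpha>. strictly_positive (s \<alpha>)) ?G"
  proof -
    \<comment> \<open>Complete mixedness is applied to a single carrier, that of \<tau>.\<close>
    have "\<exists>\<alpha>\<in>I. \<forall>\<beta>\<in>I. le \<alpha> \<beta> \<longrightarrow> profile_carrier \<tau> \<subseteq> profile_carrier (s \<beta>)"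
      using mixed \<tau>(1) by (auto simp: completely_mixed_def carriers_def)
    then show ?thesis
      unfolding eventually_net_filter[OF I] using strictly_positive_if_carrier_subset[OF \<tau>] by meson
  qed
  define \<epsilon> where "\<epsilon> m = inverse (real (Suc m))" for m
  have \<epsilon>: "\<epsilon> m > 0" for m by (simp add: \<epsilon>_def)
  have "\<exists>\<alpha>\<in>I. strictly_positive (s \<alpha>) \<and>
      (0 \<le> prohorov_dist (s \<alpha>) \<sigma> \<and> prohorov_dist (s \<alpha>) \<sigma> \<le> \<epsilon> m) \<and>
      (0 \<le> prohorov_dist (k \<alpha>) \<sigma> \<and> prohorov_dist (k \<alpha>) \<sigma> \<le> \<epsilon> m)" for m
  proof -
    have "eventually (\<lambda>\<alpha>. s \<alpha> \<in> mixed_profiles) ?G" "eventually (\<lambda>\<alpha>. k \<alpha> \<in> mixed_profiles) ?G"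
      using s k by (auto intro: eventually_mono[OF ev_I])
    then have "eventually (\<lambda>\<alpha>. \<alpha> \<in> I \<and> strictly_positive (s \<alpha>) \<and>
      (0 \<le> prohorov_dist (s \<alpha>) \<sigma> \<and> prohorov_dist (s \<alpha>) \<sigma> \<le> \<epsilon> m) \<and>
      (0 \<le> prohorov_dist (k \<alpha>) \<sigma> \<and> prohorov_dist (k \<alpha>) \<sigma> \<le> \<epsilon> m)) ?G"
      using ev_I ev_pos \<sigma> conv \<epsilon> by (intro eventually_conj converges_weakly_prohorov) auto
    \<comment> \<open>By reflexivity the index at which a tail starts belongs to the tail, so it is
      a witness itself.\<close>
    moreover have "reflp_on I le" using I by (simp add: directed_set_def)
    ultimately show ?thesis
      unfolding eventually_net_filter[OF I] by (meson reflp_onD)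
  qed
  then obtain \<alpha> where \<alpha>: "\<And>m. \<alpha> m \<in> I" "\<And>m. strictly_positive (s (\<alpha> m))"
    "\<And>m. 0 \<le> prohorov_dist (s (\<alpha> m)) \<sigma>" "\<And>m. prohorov_dist (s (\<alpha> m)) \<sigma> \<le> \<epsilon> m"
    "\<And>m. 0 \<le> prohorov_dist (k (\<alpha> m)) \<sigma>" "\<And>m. prohorov_dist (k (\<alpha> m)) \<sigma> \<le> \<epsilon> m"
    by metis
  have lim: "\<epsilon> \<longlonglongrightarrow> 0"
    unfolding \<epsilon>_def by (rule LIMSEQ_inverse_real_of_nat)
  show ?thesis
    unfolding weak_perfect_equilibrium_def
  proof (rule conjI, rule \<sigma>, rule exI[of _ "\<lambda>m. s (\<alpha> m)"], rule exI[of _ "\<lambda>m. k (\<alpha> m)"],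
      intro conjI allI impI)
    show "(\<lambda>m. prohorov_dist (s (\<alpha> m)) \<sigma>) \<longlonglongrightarrow> 0"
      using \<alpha>(3,4) by (intro tendsto_sandwich[OF _ _ tendsto_const lim]) auto
    show "(\<lambda>m. prohorov_dist (k (\<alpha> m)) \<sigma>) \<longlonglongrightarrow> 0"
      using \<alpha>(5,6) by (intro tendsto_sandwich[OF _ _ tendsto_const lim]) auto
  qed (use s k \<alpha>(1,2) br in auto)
qed

end

theorem theorem32:
  fixes n :: nat
    and A :: "nat \<Rightarrow> 'a set"
    and d :: "nat \<Rightarrow> 'a \<Rightarrow> 'a \<Rightarrow> real"
    and u :: "nat \<Rightarrow> (nat \<Rightarrow> 'a) \<Rightarrow> real"
    and \<sigma> :: "nat \<Rightarrow> 'a measure"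
  assumes "strategic_form_game n A d u"
    and "strategic_form_game.perfect_equilibrium n A d u TYPE('i) \<sigma>"
  shows "strategic_form_game.weak_perfect_equilibrium n A d u \<sigma>"
proof -
  interpret strategic_form_game n A d u by fact
  show ?thesis
    using assms(2) perfect_imp_weak_perfect_equilibrium unfolding perfect_equilibrium_def by blast
qed

end
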